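(* Let $A$ be a ring, let $X$ be a right $A$-module that is $\Sigma$-d-Rickart, and let $S=\operatorname{End}_A(X)$. Then the left $S$-module ${}_SX$ is FP-injective.
   Context: Rings are associative with unity and modules are unital; endomorphisms of the right $A$-module $X$ act on the left, making $X$ a left $S$-module. A module $M$ is d-Rickart if $\operatorname{Im}(\phi)$ is a direct summand of $M$ for every $\phi\in\operatorname{End}_A(M)$. A module $X$ is $\Sigma$-d-Rickart if the direct sum $X^{(\Lambda)}$ of $\Lambda$ copies of $X$ is d-Rickart for every non-empty index set $\Lambda$. A left $S$-module $N$ is FP-injective if for every finitely generated submodule $L$ of the free left $S$-module $S^{(\mathbb{N})}$, every monomorphism $\phi:L\to S^{(\mathbb{N})}$ and every homomorphism $\psi:L\to N$, there exists a homomorphism $\eta:S^{(\mathbb{N})}\to N$ such that $\psi=\eta\phi$. *)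

theory Defs
  imports "HOL-Algebra.Module" "HOL-Algebra.AbelCoset" "HOL-Library.Infinite_Typeclass"
begin

section \<open>One-sided modules over arbitrary rings\<close>

text \<open>
  The locale \<^locale>\<open>module\<close> of HOL-Algebra requires a commutative ring, so one-sided modules are
  introduced here.  They reuse the module record; its ring-multiplication fields
  \<^const>\<open>mult\<close> and \<^const>\<open>one\<close> are irrelevant.
\<close>

locale left_module = R?: ring + M?: abelian_group M for M (structure) +
  assumes smult_closed [simp, intro]:
      "\<lbrakk>a \<in> carrier R; x \<in> carrier M\<rbrakk> \<Longrightarrow> a \<odot>\<^bsub>M\<^esub> x \<in> carrier M"
    and smult_l_distr:
      "\<lbrakk>a \<in> carrier R; b \<in> carrier R; x \<in> carrier M\<rbrakk> \<Longrightarrow>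
        (a \<oplus> b) \<odot>\<^bsub>M\<^esub> x = a \<odot>\<^bsub>M\<^esub> x \<oplus>\<^bsub>M\<^esub> b \<odot>\<^bsub>M\<^esub> x"
    and smult_r_distr:
      "\<lbrakk>a \<in> carrier R; x \<in> carrier M; y \<in> carrier M\<rbrakk> \<Longrightarrow>
        a \<odot>\<^bsub>M\<^esub> (x \<oplus>\<^bsub>M\<^esub> y) = a \<odot>\<^bsub>M\<^esub> x \<oplus>\<^bsub>M\<^esub> a \<odot>\<^bsub>M\<^esub> y"
    and smult_assoc:
      "\<lbrakk>a \<in> carrier R; b \<in> carrier R; x \<in> carrier M\<rbrakk> \<Longrightarrow>
        (a \<otimes> b) \<odot>\<^bsub>M\<^esub> x = a \<odot>\<^bsub>M\<^esub> (b \<odot>\<^bsub>M\<^esub> x)"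
    and smult_one [simp]: "x \<in> carrier M \<Longrightarrow> \<one> \<odot>\<^bsub>M\<^esub> x = x"

text \<open>
  In a right module, \<open>a \<odot> x\<close> stands for what is written \<open>xa\<close> on paper; hence the order of the
  factors in \<open>smult_assoc\<close>, which reads \<open>x(ab) = (xa)b\<close>.
\<close>

locale right_module = R?: ring + M?: abelian_group M for M (structure) +
  assumes smult_closed [simp, intro]:
      "\<lbrakk>a \<in> carrier R; x \<in> carrier M\<rbrakk> \<Longrightarrow> a \<odot>\<^bsub>M\<^esub> x \<in> carrier M"
    and smult_l_distr:
      "\<lbrakk>a \<in> carrier R; b \<in> carrier R; x \<in> carrier M\<rbrakk> \<Longrightarrow>
        (a \<oplus> b) \<odot>\<^bsub>M\<^esub> x = a \<odot>\<^bsub>M\<^esub> x \<oplus>\<^bsub>M\<^esub> b \<odot>\<^bsub>M\<^esub> x"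
    and smult_r_distr:
      "\<lbrakk>a \<in> carrier R; x \<in> carrier M; y \<in> carrier M\<rbrakk> \<Longrightarrow>
        a \<odot>\<^bsub>M\<^esub> (x \<oplus>\<^bsub>M\<^esub> y) = a \<odot>\<^bsub>M\<^esub> x \<oplus>\<^bsub>M\<^esub> a \<odot>\<^bsub>M\<^esub> y"
    and smult_assoc:
      "\<lbrakk>a \<in> carrier R; b \<in> carrier R; x \<in> carrier M\<rbrakk> \<Longrightarrow>
        (a \<otimes> b) \<odot>\<^bsub>M\<^esub> x = b \<odot>\<^bsub>M\<^esub> (a \<odot>\<^bsub>M\<^esub> x)"
    and smult_one [simp]: "x \<in> carrier M \<Longrightarrow> \<one> \<odot>\<^bsub>M\<^esub> x = x"

text \<open>
  The following notions do not depend on the side.  The locale \<^locale>\<open>submodule\<close> of HOL-Algebra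
  makes no commutativity assumption and is used as it is.
\<close>

definition mod_hom ::
    "('r, 'p) ring_scheme \<Rightarrow> ('r, 'm, 'q) module_scheme \<Rightarrow> ('r, 'n, 's) module_scheme \<Rightarrow> ('m \<Rightarrow> 'n) set"
  where "mod_hom R M N = {f \<in> carrier M \<rightarrow> carrier N.
    (\<forall>x\<in>carrier M. \<forall>y\<in>carrier M. f (x \<oplus>\<^bsub>M\<^esub> y) = f x \<oplus>\<^bsub>N\<^esub> f y) \<and>
    (\<forall>a\<in>carrier R. \<forall>x\<in>carrier M. f (a \<odot>\<^bsub>M\<^esub> x) = a \<odot>\<^bsub>N\<^esub> f x)}"

definition mod_span :: "('r, 'p) ring_scheme \<Rightarrow> ('r, 'm, 'q) module_scheme \<Rightarrow> 'm set \<Rightarrow> 'm set"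
  where "mod_span R M G = \<Inter>{H. submodule H R M \<and> G \<subseteq> H}"

definition fg_submodule :: "'m set \<Rightarrow> ('r, 'p) ring_scheme \<Rightarrow> ('r, 'm, 'q) module_scheme \<Rightarrow> bool"
  where "fg_submodule L R M \<longleftrightarrow>
    submodule L R M \<and> (\<exists>G. finite G \<and> G \<subseteq> carrier M \<and> L = mod_span R M G)"

definition direct_summand :: "'m set \<Rightarrow> ('r, 'p) ring_scheme \<Rightarrow> ('r, 'm, 'q) module_scheme \<Rightarrow> bool"
  where "direct_summand H R M \<longleftrightarrow> submodule H R M \<and>
    (\<exists>K. submodule K R M \<and> H \<inter> K = {\<zero>\<^bsub>M\<^esub>} \<and> H <+>\<^bsub>M\<^esub> K = carrier M)"

text \<open>The direct sum of \<open>\<Lambda>\<close> copies of \<open>M\<close>: the finitely supported families.\<close>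

definition direct_power :: "'i set \<Rightarrow> ('r, 'm, 'q) module_scheme \<Rightarrow> ('r, 'i \<Rightarrow> 'm) module"
  where "direct_power \<Lambda> M =
    \<lparr>carrier = {f \<in> \<Lambda> \<rightarrow>\<^sub>E carrier M. finite {i \<in> \<Lambda>. f i \<noteq> \<zero>\<^bsub>M\<^esub>}},
     mult = undefined, one = undefined,
     zero = (\<lambda>i\<in>\<Lambda>. \<zero>\<^bsub>M\<^esub>),
     add = (\<lambda>f g. \<lambda>i\<in>\<Lambda>. f i \<oplus>\<^bsub>M\<^esub> g i),
     smult = (\<lambda>a f. \<lambda>i\<in>\<Lambda>. a \<odot>\<^bsub>M\<^esub> f i)\<rparr>"


section \<open>Endomorphism rings\<close>

text \<open>
  Endomorphisms are taken extensional on the carrier, so that equality of elements of the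
  endomorphism ring is equality of maps on the module.
\<close>

definition End_ring :: "('r, 'p) ring_scheme \<Rightarrow> ('r, 'm, 'q) module_scheme \<Rightarrow> ('m \<Rightarrow> 'm) ring"
  where "End_ring R M =
    \<lparr>carrier = mod_hom R M M \<inter> extensional (carrier M),
     mult = (\<lambda>f g. compose (carrier M) f g),
     one = (\<lambda>x\<in>carrier M. x),
     zero = (\<lambda>x\<in>carrier M. \<zero>\<^bsub>M\<^esub>),
     add = (\<lambda>f g. \<lambda>x\<in>carrier M. f x \<oplus>\<^bsub>M\<^esub> g x)\<rparr>"

text \<open>The abelian group of \<open>M\<close> as a left module over the endomorphism ring, by evaluation.\<close>

definition End_module :: "('r, 'm, 'q) module_scheme \<Rightarrow> ('m \<Rightarrow> 'm, 'm) module"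
  where "End_module M =
    \<lparr>carrier = carrier M, mult = undefined, one = undefined,
     zero = \<zero>\<^bsub>M\<^esub>, add = add M, smult = (\<lambda>f x. f x)\<rparr>"


section \<open>d-Rickart modules and FP-injectivity\<close>

definition d_rickart :: "('r, 'p) ring_scheme \<Rightarrow> ('r, 'm, 'q) module_scheme \<Rightarrow> bool"
  where "d_rickart A M \<longleftrightarrow>
    (\<forall>\<phi> \<in> carrier (End_ring A M). direct_summand (\<phi> ` carrier M) A M)"

text \<open>
  HOL cannot quantify over all sets of all types inside a formula, so the index sets \<open>\<Lambda>\<close> range
  over the non-empty subsets of a type \<open>'i\<close>, which plays the role of a universe of index sets.
  It is an arbitrary infinite type, so that at least all finite and countable cardinalities occur.
\<close>

definition sigma_d_rickart ::
    "'i::infinite itself \<Rightarrow> ('r, 'p) ring_scheme \<Rightarrow> ('r, 'm, 'q) module_scheme \<Rightarrow> bool"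
  where "sigma_d_rickart _ A X \<longleftrightarrow>
    (\<forall>\<Lambda> :: 'i set. \<Lambda> \<noteq> {} \<longrightarrow> d_rickart A (direct_power \<Lambda> X))"

definition regular_left_module :: "('s, 'p) ring_scheme \<Rightarrow> ('s, 's) module"
  where "regular_left_module S =
    \<lparr>carrier = carrier S, mult = mult S, one = one S,
     zero = zero S, add = add S, smult = mult S\<rparr>"

definition free_left_module :: "('s, 'p) ring_scheme \<Rightarrow> ('s, nat \<Rightarrow> 's) module"
  where "free_left_module S = direct_power (UNIV :: nat set) (regular_left_module S)"

definition fp_injective :: "('s, 'p) ring_scheme \<Rightarrow> ('s, 'n, 'q) module_scheme \<Rightarrow> bool"
  where "fp_injective S N \<longleftrightarrow>
    (\<forall>L \<phi> \<psi>. fg_submodule L S (free_left_module S) \<longrightarrow>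
       \<phi> \<in> mod_hom S ((free_left_module S)\<lparr>carrier := L\<rparr>) (free_left_module S) \<longrightarrow> inj_on \<phi> L \<longrightarrow>
       \<psi> \<in> mod_hom S ((free_left_module S)\<lparr>carrier := L\<rparr>) N \<longrightarrow>
       (\<exists>\<eta> \<in> mod_hom S (free_left_module S) N. \<forall>x\<in>L. \<psi> x = \<eta> (\<phi> x)))"


section \<open>Well-definedness\<close>

lemma direct_power_mem:
  "f \<in> carrier (direct_power \<Lambda> M) \<Longrightarrow> i \<in> \<Lambda> \<Longrightarrow> f i \<in> carrier M"
  by (auto simp: direct_power_def)

lemma direct_power_restrict:
  "f \<in> carrier (direct_power \<Lambda> M) \<Longrightarrow> restrict f \<Lambda> = f"
  by (auto simp: direct_power_def PiE_restrict)

lemma direct_power_ops: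
  "\<zero>\<^bsub>direct_power \<Lambda> M\<^esub> = (\<lambda>i\<in>\<Lambda>. \<zero>\<^bsub>M\<^esub>)"
  "f \<oplus>\<^bsub>direct_power \<Lambda> M\<^esub> g = (\<lambda>i\<in>\<Lambda>. f i \<oplus>\<^bsub>M\<^esub> g i)"
  "a \<odot>\<^bsub>direct_power \<Lambda> M\<^esub> f = (\<lambda>i\<in>\<Lambda>. a \<odot>\<^bsub>M\<^esub> f i)"
  by (simp_all add: direct_power_def)

lemma abelian_group_direct_power:
  assumes "abelian_group M"
  shows "abelian_group (direct_power \<Lambda> M)"
proof -
  interpret abelian_group M by fact
  show ?thesis
  proof (rule abelian_groupI)
    fix f g assume f: "f \<in> carrier (direct_power \<Lambda> M)" and g: "g \<in> carrier (direct_power \<Lambda> M)"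
    have "{i \<in> \<Lambda>. f i \<oplus>\<^bsub>M\<^esub> g i \<noteq> \<zero>\<^bsub>M\<^esub>} \<subseteq> {i \<in> \<Lambda>. f i \<noteq> \<zero>\<^bsub>M\<^esub>} \<union> {i \<in> \<Lambda>. g i \<noteq> \<zero>\<^bsub>M\<^esub>}"
      by auto
    then have "finite {i \<in> \<Lambda>. f i \<oplus>\<^bsub>M\<^esub> g i \<noteq> \<zero>\<^bsub>M\<^esub>}"
      by (rule finite_subset) (use f g in \<open>auto simp: direct_power_def\<close>)
    with f g show "f \<oplus>\<^bsub>direct_power \<Lambda> M\<^esub> g \<in> carrier (direct_power \<Lambda> M)"
      by (auto simp: direct_power_def PiE_mem cong: conj_cong)
  next
    fix f assume f: "f \<in> carrier (direct_power \<Lambda> M)"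
    let ?g = "\<lambda>i\<in>\<Lambda>. \<ominus>\<^bsub>M\<^esub> f i"
    have "{i \<in> \<Lambda>. \<ominus>\<^bsub>M\<^esub> f i \<noteq> \<zero>\<^bsub>M\<^esub>} \<subseteq> {i \<in> \<Lambda>. f i \<noteq> \<zero>\<^bsub>M\<^esub>}"
      by auto
    then have "finite {i \<in> \<Lambda>. \<ominus>\<^bsub>M\<^esub> f i \<noteq> \<zero>\<^bsub>M\<^esub>}"
      by (rule finite_subset) (use f in \<open>auto simp: direct_power_def\<close>)
    with f have "?g \<in> carrier (direct_power \<Lambda> M)"
      by (auto simp: direct_power_def PiE_mem cong: conj_cong)
    moreover from f have "?g \<oplus>\<^bsub>direct_power \<Lambda> M\<^esub> f = \<zero>\<^bsub>direct_power \<Lambda> M\<^esub>"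
      by (auto simp: direct_power_def fun_eq_iff intro!: l_neg)
    ultimately show "\<exists>g\<in>carrier (direct_power \<Lambda> M). g \<oplus>\<^bsub>direct_power \<Lambda> M\<^esub> f = \<zero>\<^bsub>direct_power \<Lambda> M\<^esub>"
      by blast
  next
    fix f assume f: "f \<in> carrier (direct_power \<Lambda> M)"
    have "(\<lambda>i\<in>\<Lambda>. \<zero>\<^bsub>M\<^esub> \<oplus>\<^bsub>M\<^esub> f i) = restrict f \<Lambda>"
      by (rule restrict_ext) (simp add: direct_power_mem[OF f])
    then show "\<zero>\<^bsub>direct_power \<Lambda> M\<^esub> \<oplus>\<^bsub>direct_power \<Lambda> M\<^esub> f = f"
      by (simp add: direct_power_ops direct_power_restrict[OF f] cong: restrict_cong)
  next
    show "\<zero>\<^bsub>direct_power \<Lambda> M\<^esub> \<in> carrier (direct_power \<Lambda> M)"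
      by (auto simp: direct_power_def cong: conj_cong)
  qed (auto simp: direct_power_ops add.m_ac direct_power_mem intro!: restrict_ext)
qed

lemma left_module_direct_power:
  assumes "left_module R M"
  shows "left_module R (direct_power \<Lambda> M)"
proof -
  interpret left_module R M by fact
  have r_null: "a \<odot>\<^bsub>M\<^esub> \<zero>\<^bsub>M\<^esub> = \<zero>\<^bsub>M\<^esub>" if "a \<in> carrier R" for a
    using that smult_r_distr[of a "\<zero>\<^bsub>M\<^esub>" "\<zero>\<^bsub>M\<^esub>"] M.add.l_cancel_one' by (metis M.l_zero M.zero_closed smult_closed)
  show ?thesis
  proof (intro left_module.intro abelian_group_direct_power left_module_axioms.intro)
    fix a f assume a: "a \<in> carrier R" and f: "f \<in> carrier (direct_power \<Lambda> M)"
    have "{i \<in> \<Lambda>. a \<odot>\<^bsub>M\<^esub> f i \<noteq> \<zero>\<^bsub>M\<^esub>} \<subseteq> {i \<in> \<Lambda>. f i \<noteq> \<zero>\<^bsub>M\<^esub>}"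
      using r_null[OF a] by auto
    then have "finite {i \<in> \<Lambda>. a \<odot>\<^bsub>M\<^esub> f i \<noteq> \<zero>\<^bsub>M\<^esub>}"
      by (rule finite_subset) (use f in \<open>auto simp: direct_power_def\<close>)
    with a f show "a \<odot>\<^bsub>direct_power \<Lambda> M\<^esub> f \<in> carrier (direct_power \<Lambda> M)"
      by (auto simp: direct_power_def PiE_mem cong: conj_cong)
  next
    fix f assume f: "f \<in> carrier (direct_power \<Lambda> M)"
    have "(\<lambda>i\<in>\<Lambda>. \<one>\<^bsub>R\<^esub> \<odot>\<^bsub>M\<^esub> f i) = restrict f \<Lambda>"
      by (rule restrict_ext) (simp add: direct_power_mem[OF f])
    then show "\<one>\<^bsub>R\<^esub> \<odot>\<^bsub>direct_power \<Lambda> M\<^esub> f = f"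
      by (simp add: direct_power_ops direct_power_restrict[OF f])
  qed (auto simp: direct_power_ops direct_power_mem smult_l_distr smult_r_distr smult_assoc
         intro!: restrict_ext R.ring_axioms M.abelian_group_axioms)
qed

lemma right_module_direct_power:
  assumes "right_module R M"
  shows "right_module R (direct_power \<Lambda> M)"
proof -
  interpret right_module R M by fact
  have r_null: "a \<odot>\<^bsub>M\<^esub> \<zero>\<^bsub>M\<^esub> = \<zero>\<^bsub>M\<^esub>" if "a \<in> carrier R" for a
    using that smult_r_distr[of a "\<zero>\<^bsub>M\<^esub>" "\<zero>\<^bsub>M\<^esub>"] M.add.l_cancel_one' by (metis M.l_zero M.zero_closed smult_closed)
  show ?thesis
  proof (intro right_module.intro abelian_group_direct_power right_module_axioms.intro)
    fix a f assume a: "a \<in> carrier R" and f: "f \<in> carrier (direct_power \<Lambda> M)"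
    have "{i \<in> \<Lambda>. a \<odot>\<^bsub>M\<^esub> f i \<noteq> \<zero>\<^bsub>M\<^esub>} \<subseteq> {i \<in> \<Lambda>. f i \<noteq> \<zero>\<^bsub>M\<^esub>}"
      using r_null[OF a] by auto
    then have "finite {i \<in> \<Lambda>. a \<odot>\<^bsub>M\<^esub> f i \<noteq> \<zero>\<^bsub>M\<^esub>}"
      by (rule finite_subset) (use f in \<open>auto simp: direct_power_def\<close>)
    with a f show "a \<odot>\<^bsub>direct_power \<Lambda> M\<^esub> f \<in> carrier (direct_power \<Lambda> M)"
      by (auto simp: direct_power_def PiE_mem cong: conj_cong)
  next
    fix f assume f: "f \<in> carrier (direct_power \<Lambda> M)"
    have "(\<lambda>i\<in>\<Lambda>. \<one>\<^bsub>R\<^esub> \<odot>\<^bsub>M\<^esub> f i) = restrict f \<Lambda>"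
      by (rule restrict_ext) (simp add: direct_power_mem[OF f])
    then show "\<one>\<^bsub>R\<^esub> \<odot>\<^bsub>direct_power \<Lambda> M\<^esub> f = f"
      by (simp add: direct_power_ops direct_power_restrict[OF f])
  qed (auto simp: direct_power_ops direct_power_mem smult_l_distr smult_r_distr smult_assoc
         intro!: restrict_ext R.ring_axioms M.abelian_group_axioms)
qed

lemma left_module_regular:
  assumes "ring S"
  shows "left_module S (regular_left_module S)"
proof -
  interpret ring S by fact
  have "abelian_group (regular_left_module S)"
    by (rule abelian_groupI)
      (auto simp: regular_left_module_def add.m_ac intro: bexI[of _ "\<ominus>\<^bsub>S\<^esub> _"] l_neg)
  then show ?thesis
    by (intro left_module.intro left_module_axioms.intro assms)
      (auto simp: regular_left_module_def l_distr r_distr m_assoc)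
qed

lemma left_module_free: "ring S \<Longrightarrow> left_module S (free_left_module S)"
  by (simp add: free_left_module_def left_module_direct_power left_module_regular)

lemma ring_End_ring:
  assumes "right_module A X"
  shows "ring (End_ring A X)"
proof -
  interpret right_module A X by fact
  have r_null: "a \<odot>\<^bsub>X\<^esub> \<zero>\<^bsub>X\<^esub> = \<zero>\<^bsub>X\<^esub>" if "a \<in> carrier A" for a
    using that smult_r_distr[of a "\<zero>\<^bsub>X\<^esub>" "\<zero>\<^bsub>X\<^esub>"] M.add.l_cancel_one' by (metis M.l_zero M.zero_closed smult_closed)
  have r_minus: "a \<odot>\<^bsub>X\<^esub> (\<ominus>\<^bsub>X\<^esub> x) = \<ominus>\<^bsub>X\<^esub> (a \<odot>\<^bsub>X\<^esub> x)" if "a \<in> carrier A" "x \<in> carrier X" for a x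
    by (metis M.a_inv_closed M.l_neg M.minus_equality r_null smult_closed smult_r_distr that)
  have closed: "f x \<in> carrier X" if "f \<in> mod_hom A X X" "x \<in> carrier X" for f x
    using that by (auto simp: mod_hom_def)
  have add: "f (x \<oplus>\<^bsub>X\<^esub> y) = f x \<oplus>\<^bsub>X\<^esub> f y"
    if "f \<in> mod_hom A X X" "x \<in> carrier X" "y \<in> carrier X" for f x y
    using that by (auto simp: mod_hom_def)
  have smult: "f (a \<odot>\<^bsub>X\<^esub> x) = a \<odot>\<^bsub>X\<^esub> f x"
    if "f \<in> mod_hom A X X" "x \<in> carrier X" "a \<in> carrier A" for f x a
    using that by (auto simp: mod_hom_def)
  have ab: "abelian_group (End_ring A X)"
  proof (rule abelian_groupI)
    fix f g assume "f \<in> carrier (End_ring A X)" "g \<in> carrier (End_ring A X)"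
    then have f: "f \<in> mod_hom A X X" and g: "g \<in> mod_hom A X X"
      by (auto simp: End_ring_def)
    have "(\<lambda>x\<in>carrier X. f x \<oplus>\<^bsub>X\<^esub> g x) \<in> mod_hom A X X"
      unfolding mod_hom_def using f g
      by (auto simp: closed add smult smult_r_distr M.add.m_ac)
    then show "f \<oplus>\<^bsub>End_ring A X\<^esub> g \<in> carrier (End_ring A X)"
      by (simp add: End_ring_def)
  next
    show "\<zero>\<^bsub>End_ring A X\<^esub> \<in> carrier (End_ring A X)"
      by (auto simp: End_ring_def mod_hom_def r_null)
  next
    fix f assume "f \<in> carrier (End_ring A X)"
    then have f: "f \<in> mod_hom A X X"
      by (auto simp: End_ring_def)
    have "(\<lambda>x\<in>carrier X. \<ominus>\<^bsub>X\<^esub> f x) \<in> mod_hom A X X"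
      unfolding mod_hom_def using f
      by (auto simp: closed add smult r_minus M.minus_add)
    then have "(\<lambda>x\<in>carrier X. \<ominus>\<^bsub>X\<^esub> f x) \<in> carrier (End_ring A X)"
      by (simp add: End_ring_def)
    moreover have "(\<lambda>x\<in>carrier X. \<ominus>\<^bsub>X\<^esub> f x) \<oplus>\<^bsub>End_ring A X\<^esub> f = \<zero>\<^bsub>End_ring A X\<^esub>"
      using f by (auto simp: End_ring_def fun_eq_iff closed M.l_neg)
    ultimately show "\<exists>g\<in>carrier (End_ring A X). g \<oplus>\<^bsub>End_ring A X\<^esub> f = \<zero>\<^bsub>End_ring A X\<^esub>"
      by blast
  qed (auto simp: End_ring_def fun_eq_iff closed M.add.m_ac extensional_def)
  have mon: "monoid (End_ring A X)"
  proof (rule monoidI)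
    fix f g assume "f \<in> carrier (End_ring A X)" "g \<in> carrier (End_ring A X)"
    then have f: "f \<in> mod_hom A X X" and g: "g \<in> mod_hom A X X"
      by (auto simp: End_ring_def)
    have "compose (carrier X) f g \<in> mod_hom A X X"
      unfolding mod_hom_def using f g
      by (auto simp: closed add smult compose_def)
    then show "f \<otimes>\<^bsub>End_ring A X\<^esub> g \<in> carrier (End_ring A X)"
      by (simp add: End_ring_def)
  next
    show "\<one>\<^bsub>End_ring A X\<^esub> \<in> carrier (End_ring A X)"
      by (auto simp: End_ring_def mod_hom_def)
  qed (auto simp: End_ring_def fun_eq_iff closed compose_def extensional_def)
  show ?thesis
    by (rule ringI[OF ab mon])
      (auto simp: End_ring_def fun_eq_iff closed add compose_def)
qed

lemma left_module_End_module:
  assumes "right_module A X"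
  shows "left_module (End_ring A X) (End_module X)"
proof -
  interpret right_module A X by fact
  have "abelian_group (End_module X)"
    by (rule abelian_groupI)
      (auto simp: End_module_def M.add.m_ac intro: bexI[of _ "\<ominus>\<^bsub>X\<^esub> _"] M.l_neg)
  then show ?thesis
    by (intro left_module.intro left_module_axioms.intro ring_End_ring assms)
      (auto simp: End_module_def End_ring_def mod_hom_def compose_def)
qed

end

theory Submission
  imports Defs
begin

text \<open>
  Let \<open>l\<^sub>r\<close> be finitely many generators of \<open>L\<close>.  Only finitely many coordinates of the \<open>\<phi> l\<^sub>r\<close> are
  non-zero, so they form a finite matrix \<open>Y\<close> over \<open>S\<close>, which acts on \<open>X\<^sup>k\<close> for \<open>k\<close> large enough, and the
  required \<open>\<eta>\<close> is a solution \<open>e\<close> of \<open>Y e = \<xi>\<close> with \<open>\<xi>\<^sub>r = \<psi> l\<^sub>r\<close>.  As \<open>X\<^sup>k\<close> is d-Rickart, the image of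
  \<open>Y\<close> is the kernel of some endomorphism \<open>p\<close> of \<open>X\<^sup>k\<close>.  The rows of \<open>p\<close>, regarded as a matrix over \<open>S\<close>,
  are relations between the \<open>\<phi> l\<^sub>r\<close>, hence between the \<open>l\<^sub>r\<close> since \<open>\<phi>\<close> is injective, hence between the
  \<open>\<psi> l\<^sub>r\<close>.  So \<open>p \<xi> = 0\<close>, that is, \<open>\<xi>\<close> lies in the image of \<open>Y\<close>.
\<close>

section \<open>Additive maps, submodules and finite direct powers\<close>

lemma abelian_group_homI_add:
  assumes "abelian_group G" "abelian_group H" "h \<in> carrier G \<rightarrow> carrier H"
    and "\<And>x y. x \<in> carrier G \<Longrightarrow> y \<in> carrier G \<Longrightarrow> h (x \<oplus>\<^bsub>G\<^esub> y) = h x \<oplus>\<^bsub>H\<^esub> h y"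
  shows "abelian_group_hom G H h"
  using assms
  by (intro abelian_group_homI group_hom.intro group_hom_axioms.intro abelian_group.a_group)
    (auto simp: hom_def)

lemma mod_hom_abelian_group_hom:
  assumes "abelian_group M" "abelian_group N" "f \<in> mod_hom R M N"
  shows "abelian_group_hom M N f"
  using assms by (intro abelian_group_homI_add) (auto simp: mod_hom_def)

text \<open>For finite \<open>I\<close> this is additivity iterated; for infinite \<open>I\<close>
  both sums are zero by convention, and \<open>h\<close> preserves zero.\<close>

lemma (in abelian_group_hom) hom_finsum:
  assumes "f \<in> I \<rightarrow> carrier G"
  shows "h (\<Oplus>\<^bsub>G\<^esub>i\<in>I. f i) = (\<Oplus>\<^bsub>H\<^esub>i\<in>I. h (f i))"
  using assms
proof (induction I rule: infinite_finite_induct)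
  case (insert i I)
  then have "f i \<in> carrier G" "f \<in> I \<rightarrow> carrier G" "(\<lambda>i. h (f i)) \<in> I \<rightarrow> carrier H"
    by (auto simp: Pi_iff)
  with insert show ?case by simp
qed auto

text \<open>Makes a submodule a module in its own right, so that a homomorphism defined only on
  \<open>H\<close> can be treated as an additive map between abelian groups.\<close>

lemma (in submodule) left_module_submodule:
  assumes "left_module R M"
  shows "left_module R (M\<lparr>carrier := H\<rparr>)"
proof -
  note closed = m_closed one_closed
  interpret left_module R M by fact
  have H: "x \<in> carrier M" if "x \<in> H" for x
    using that subset by auto
  have ab: "abelian_group (M\<lparr>carrier := H\<rparr>)"
  proof (rule abelian_groupI)
    fix x assume "x \<in> carrier (M\<lparr>carrier := H\<rparr>)"
    then show "\<exists>y\<in>carrier (M\<lparr>carrier := H\<rparr>). y \<oplus>\<^bsub>M\<lparr>carrier := H\<rparr>\<^esub> x = \<zero>\<^bsub>M\<lparr>carrier := H\<rparr>\<^esub>"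
      using H m_inv_closed[of x] M.l_neg[of x] by (intro bexI[of _ "\<ominus>\<^bsub>M\<^esub> x"]) (auto simp: a_inv_def)
  qed (use closed in \<open>simp_all add: H M.a_ac\<close>)
  show ?thesis
    by (intro left_module.intro left_module_axioms.intro ab R.ring_axioms)
      (simp_all add: H smult_l_distr smult_r_distr smult_assoc)
qed

lemma (in submodule) mod_span_subset: "G \<subseteq> H \<Longrightarrow> mod_span R M G \<subseteq> H"
  unfolding mod_span_def using submodule_axioms by auto

lemma abelian_group_hom_direct_power_proj:
  assumes "abelian_group M" "i \<in> \<Lambda>"
  shows "abelian_group_hom (direct_power \<Lambda> M) M (\<lambda>f. f i)"
  using assms
  by (intro abelian_group_homI_add abelian_group_direct_power) (auto simp: direct_power_def)

lemma direct_power_eqI: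
  assumes "f \<in> carrier (direct_power \<Lambda> M)" "g \<in> carrier (direct_power \<Lambda> M)"
    and "\<And>i. i \<in> \<Lambda> \<Longrightarrow> f i = g i"
  shows "f = g"
  using assms by (auto simp: direct_power_def intro: PiE_ext)

lemma carrier_direct_power_finite:
  "finite \<Lambda> \<Longrightarrow> carrier (direct_power \<Lambda> M) = \<Lambda> \<rightarrow>\<^sub>E carrier M"
  by (auto simp: direct_power_def)

section \<open>Matrices of endomorphisms and linear systems over a right module\<close>

context right_module
begin

lemma r_null: "a \<in> carrier R \<Longrightarrow> a \<odot>\<^bsub>M\<^esub> \<zero>\<^bsub>M\<^esub> = \<zero>\<^bsub>M\<^esub>"
  using smult_r_distr[of a "\<zero>\<^bsub>M\<^esub>" "\<zero>\<^bsub>M\<^esub>"] M.add.l_cancel_one'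
  by (metis M.l_zero M.zero_closed smult_closed)

lemma finsum_smult:
  assumes "a \<in> carrier R" "f \<in> I \<rightarrow> carrier M"
  shows "a \<odot>\<^bsub>M\<^esub> (\<Oplus>\<^bsub>M\<^esub>i\<in>I. f i) = (\<Oplus>\<^bsub>M\<^esub>i\<in>I. a \<odot>\<^bsub>M\<^esub> f i)"
proof -
  interpret abelian_group_hom M M "\<lambda>x. a \<odot>\<^bsub>M\<^esub> x"
    using assms(1) by (intro abelian_group_homI_add M.abelian_group_axioms) (auto simp: smult_r_distr)
  show ?thesis using assms(2) by (rule hom_finsum)
qed

text \<open>A square matrix of endomorphisms acts on columns. Each entry is additive and commutes
  with scalars, and both properties pass through the finite row sums.\<close>

lemma mod_hom_matrix:
  assumes "\<And>r c. r \<in> \<Lambda> \<Longrightarrow> c \<in> \<Lambda> \<Longrightarrow> y r c \<in> mod_hom R M M" "finite \<Lambda>"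
  shows "(\<lambda>f. \<lambda>r\<in>\<Lambda>. \<Oplus>\<^bsub>M\<^esub>c\<in>\<Lambda>. y r c (f c)) \<in> mod_hom R (direct_power \<Lambda> M) (direct_power \<Lambda> M)"
proof -
  have cl: "y r c x \<in> carrier M" if "r \<in> \<Lambda>" "c \<in> \<Lambda>" "x \<in> carrier M" for r c x
    using assms(1)[of r c] that by (auto simp: mod_hom_def)
  have add: "y r c (x \<oplus>\<^bsub>M\<^esub> x') = y r c x \<oplus>\<^bsub>M\<^esub> y r c x'"
    if "r \<in> \<Lambda>" "c \<in> \<Lambda>" "x \<in> carrier M" "x' \<in> carrier M" for r c x x'
    using assms(1)[of r c] that by (auto simp: mod_hom_def)
  have smult: "y r c (a \<odot>\<^bsub>M\<^esub> x) = a \<odot>\<^bsub>M\<^esub> y r c x"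
    if "r \<in> \<Lambda>" "c \<in> \<Lambda>" "x \<in> carrier M" "a \<in> carrier R" for r c x a
    using assms(1)[of r c] that by (auto simp: mod_hom_def)
  show ?thesis
    unfolding mod_hom_def carrier_direct_power_finite[OF assms(2)]
  proof (intro CollectI conjI ballI)
    show "(\<lambda>f. \<lambda>r\<in>\<Lambda>. \<Oplus>\<^bsub>M\<^esub>c\<in>\<Lambda>. y r c (f c)) \<in> (\<Lambda> \<rightarrow>\<^sub>E carrier M) \<rightarrow> (\<Lambda> \<rightarrow>\<^sub>E carrier M)"
      by (auto intro!: M.finsum_closed cl)
  next
    fix f g assume "f \<in> \<Lambda> \<rightarrow>\<^sub>E carrier M" "g \<in> \<Lambda> \<rightarrow>\<^sub>E carrier M"
    then have fg: "f c \<in> carrier M" "g c \<in> carrier M" if "c \<in> \<Lambda>" for c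
      using that by auto
    have "(\<Oplus>\<^bsub>M\<^esub>c\<in>\<Lambda>. y r c ((f \<oplus>\<^bsub>direct_power \<Lambda> M\<^esub> g) c)) =
        (\<Oplus>\<^bsub>M\<^esub>c\<in>\<Lambda>. y r c (f c)) \<oplus>\<^bsub>M\<^esub> (\<Oplus>\<^bsub>M\<^esub>c\<in>\<Lambda>. y r c (g c))" if "r \<in> \<Lambda>" for r
    proof -
      have "(\<Oplus>\<^bsub>M\<^esub>c\<in>\<Lambda>. y r c ((f \<oplus>\<^bsub>direct_power \<Lambda> M\<^esub> g) c)) = (\<Oplus>\<^bsub>M\<^esub>c\<in>\<Lambda>. y r c (f c) \<oplus>\<^bsub>M\<^esub> y r c (g c))"
        using fg that by (intro M.finsum_cong') (auto simp: direct_power_ops cl add)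
      also have "\<dots> = (\<Oplus>\<^bsub>M\<^esub>c\<in>\<Lambda>. y r c (f c)) \<oplus>\<^bsub>M\<^esub> (\<Oplus>\<^bsub>M\<^esub>c\<in>\<Lambda>. y r c (g c))"
        using fg that by (intro M.finsum_addf) (auto simp: cl)
      finally show ?thesis .
    qed
    then show "(\<lambda>r\<in>\<Lambda>. \<Oplus>\<^bsub>M\<^esub>c\<in>\<Lambda>. y r c ((f \<oplus>\<^bsub>direct_power \<Lambda> M\<^esub> g) c)) =
        (\<lambda>r\<in>\<Lambda>. \<Oplus>\<^bsub>M\<^esub>c\<in>\<Lambda>. y r c (f c)) \<oplus>\<^bsub>direct_power \<Lambda> M\<^esub> (\<lambda>r\<in>\<Lambda>. \<Oplus>\<^bsub>M\<^esub>c\<in>\<Lambda>. y r c (g c))"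
      by (auto simp: direct_power_ops(2)[of \<Lambda> M "restrict _ _"] cong: restrict_cong)
  next
    fix a f assume a: "a \<in> carrier R" and "f \<in> \<Lambda> \<rightarrow>\<^sub>E carrier M"
    then have "f c \<in> carrier M" if "c \<in> \<Lambda>" for c
      using that by auto
    with a have "(\<Oplus>\<^bsub>M\<^esub>c\<in>\<Lambda>. y r c ((a \<odot>\<^bsub>direct_power \<Lambda> M\<^esub> f) c)) = a \<odot>\<^bsub>M\<^esub> (\<Oplus>\<^bsub>M\<^esub>c\<in>\<Lambda>. y r c (f c))"
      if "r \<in> \<Lambda>" for r
      using that by (subst finsum_smult)
        (auto simp: direct_power_ops cl smult intro!: M.finsum_cong')
    then show "(\<lambda>r\<in>\<Lambda>. \<Oplus>\<^bsub>M\<^esub>c\<in>\<Lambda>. y r c ((a \<odot>\<^bsub>direct_power \<Lambda> M\<^esub> f) c)) =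
        a \<odot>\<^bsub>direct_power \<Lambda> M\<^esub> (\<lambda>r\<in>\<Lambda>. \<Oplus>\<^bsub>M\<^esub>c\<in>\<Lambda>. y r c (f c))"
      by (auto simp: direct_power_ops(3)[of \<Lambda> M _ "restrict _ _"] cong: restrict_cong)
  qed
qed

text \<open>The projection onto a complement \<open>K\<close> along \<open>H\<close> has kernel
  \<open>H\<close>. Membership in a summand thereby becomes an equation.\<close>

lemma direct_summand_kernel:
  assumes "direct_summand H R M"
  obtains p where "p \<in> mod_hom R M M" "\<And>x. x \<in> carrier M \<Longrightarrow> p x = \<zero>\<^bsub>M\<^esub> \<longleftrightarrow> x \<in> H"
proof -
  obtain K where H: "submodule H R M" and K: "submodule K R M"
    and HK: "H \<inter> K = {\<zero>\<^bsub>M\<^esub>}" "H <+>\<^bsub>M\<^esub> K = carrier M"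
    using assms by (auto simp: direct_summand_def)
  interpret H: submodule H R M by fact
  interpret K: submodule K R M by fact
  have Hc: "H \<subseteq> carrier M" and Kc: "K \<subseteq> carrier M"
    using H.subset K.subset by auto
  \<comment> \<open>Two decompositions of one element differ by an element of \<open>H\<close> that
    equals an element of \<open>K\<close>, hence by zero.\<close>
  have uniq: "k = k'" if "h \<in> H" "k \<in> K" "h' \<in> H" "k' \<in> K" "h \<oplus>\<^bsub>M\<^esub> k = h' \<oplus>\<^bsub>M\<^esub> k'" for h k h' k'
  proof -
    have c: "h \<in> carrier M" "k \<in> carrier M" "h' \<in> carrier M" "k' \<in> carrier M"
      using that Hc Kc by auto
    have "\<ominus>\<^bsub>M\<^esub> h' \<oplus>\<^bsub>M\<^esub> h = \<ominus>\<^bsub>M\<^esub> h' \<oplus>\<^bsub>M\<^esub> ((h \<oplus>\<^bsub>M\<^esub> k) \<oplus>\<^bsub>M\<^esub> \<ominus>\<^bsub>M\<^esub> k)"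
      using c by (simp add: M.a_assoc M.r_neg)
    also have "\<dots> = k' \<oplus>\<^bsub>M\<^esub> \<ominus>\<^bsub>M\<^esub> k"
      unfolding that(5) using c by (simp add: M.a_assoc M.r_neg1)
    finally have eq: "\<ominus>\<^bsub>M\<^esub> h' \<oplus>\<^bsub>M\<^esub> h = k' \<oplus>\<^bsub>M\<^esub> \<ominus>\<^bsub>M\<^esub> k" .
    have "\<ominus>\<^bsub>M\<^esub> h' \<oplus>\<^bsub>M\<^esub> h \<in> H" "k' \<oplus>\<^bsub>M\<^esub> \<ominus>\<^bsub>M\<^esub> k \<in> K"
      using that H.m_closed H.m_inv_closed K.m_closed K.m_inv_closed by (auto simp: a_inv_def)
    with eq HK(1) have "k' \<oplus>\<^bsub>M\<^esub> \<ominus>\<^bsub>M\<^esub> k = \<zero>\<^bsub>M\<^esub>" by auto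
    then show ?thesis using c by (metis M.add.inv_equality M.minus_equality M.minus_minus M.add.inv_closed)
  qed
  \<comment> \<open>The projection along \<open>H\<close>; the description is meaningful because the
    component in \<open>K\<close> exists by \<open>HK(2)\<close> and is unique by
    \<open>uniq\<close>.\<close>
  define p where "p x = (THE k. k \<in> K \<and> (\<exists>h\<in>H. x = h \<oplus>\<^bsub>M\<^esub> k))" for x
  have p_eq: "p (h \<oplus>\<^bsub>M\<^esub> k) = k" if "h \<in> H" "k \<in> K" for h k
    unfolding p_def using that uniq by (intro the_equality) blast+
  have ex: "\<exists>h\<in>H. \<exists>k\<in>K. x = h \<oplus>\<^bsub>M\<^esub> k" if "x \<in> carrier M" for x
    using that unfolding HK(2)[symmetric] set_add_def' by auto
  show thesis
  proof
    show "p \<in> mod_hom R M M"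
      unfolding mod_hom_def
    proof (intro CollectI conjI ballI Pi_I)
      fix x assume "x \<in> carrier M"
      then obtain h k where "h \<in> H" "k \<in> K" "x = h \<oplus>\<^bsub>M\<^esub> k" using ex by blast
      then show "p x \<in> carrier M" using p_eq Kc by auto
    next
      fix x x' assume "x \<in> carrier M" "x' \<in> carrier M"
      then obtain h k h' k' where hk: "h \<in> H" "k \<in> K" "x = h \<oplus>\<^bsub>M\<^esub> k" "h' \<in> H" "k' \<in> K" "x' = h' \<oplus>\<^bsub>M\<^esub> k'"
        using ex by metis
      then have "x \<oplus>\<^bsub>M\<^esub> x' = (h \<oplus>\<^bsub>M\<^esub> h') \<oplus>\<^bsub>M\<^esub> (k \<oplus>\<^bsub>M\<^esub> k')"
        using Hc Kc by (auto simp: subset_iff M.a_ac)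
      then show "p (x \<oplus>\<^bsub>M\<^esub> x') = p x \<oplus>\<^bsub>M\<^esub> p x'"
        using hk H.m_closed K.m_closed by (simp add: p_eq)
    next
      fix a x assume a: "a \<in> carrier R" and "x \<in> carrier M"
      then obtain h k where hk: "h \<in> H" "k \<in> K" "x = h \<oplus>\<^bsub>M\<^esub> k" using ex by blast
      then have "a \<odot>\<^bsub>M\<^esub> x = a \<odot>\<^bsub>M\<^esub> h \<oplus>\<^bsub>M\<^esub> a \<odot>\<^bsub>M\<^esub> k"
        using a Hc Kc by (simp add: smult_r_distr subset_iff)
      then show "p (a \<odot>\<^bsub>M\<^esub> x) = a \<odot>\<^bsub>M\<^esub> p x"
        using a hk by (simp add: p_eq)
    qed
    fix x assume "x \<in> carrier M"
    then obtain h k where hk: "h \<in> H" "k \<in> K" "x = h \<oplus>\<^bsub>M\<^esub> k" using ex by blast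
    \<comment> \<open>An element of \<open>H\<close> also decomposes as itself plus zero, so
      uniqueness applies.\<close>
    have "k = \<zero>\<^bsub>M\<^esub>" if "x \<in> H"
      using uniq[of x "\<zero>\<^bsub>M\<^esub>" h k] hk that HK(1) \<open>x \<in> carrier M\<close> by auto
    moreover have "x \<in> H" if "k = \<zero>\<^bsub>M\<^esub>"
      using hk that Hc by auto
    ultimately show "p x = \<zero>\<^bsub>M\<^esub> \<longleftrightarrow> x \<in> H"
      using p_eq hk by auto
  qed
qed

text \<open>The condition \<open>rel\<close> is the obvious necessary one: every left relation
  between the rows of \<open>y\<close> must hold between the right-hand sides \<open>\<xi>\<close>.
  It suffices because the image of the matrix is the kernel of an endomorphism whose own rows are
  such relations.\<close>

lemma matrix_equation_solvable:
  fixes \<Lambda> :: "'i set"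
  defines "S \<equiv> End_ring R M"
  assumes fin: "finite \<Lambda>" and rick: "d_rickart R (direct_power \<Lambda> M)"
    and y: "\<And>r c. r \<in> \<Lambda> \<Longrightarrow> c \<in> \<Lambda> \<Longrightarrow> y r c \<in> carrier S"
    and \<xi>: "\<xi> \<in> \<Lambda> \<rightarrow> carrier M"
    and rel: "\<And>s. s \<in> \<Lambda> \<rightarrow> carrier S \<Longrightarrow>
      (\<And>c. c \<in> \<Lambda> \<Longrightarrow> (\<Oplus>\<^bsub>S\<^esub>r\<in>\<Lambda>. s r \<otimes>\<^bsub>S\<^esub> y r c) = \<zero>\<^bsub>S\<^esub>) \<Longrightarrow>
      (\<Oplus>\<^bsub>M\<^esub>r\<in>\<Lambda>. s r (\<xi> r)) = \<zero>\<^bsub>M\<^esub>"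
  obtains e where "e \<in> \<Lambda> \<rightarrow> carrier M" "\<And>r. r \<in> \<Lambda> \<Longrightarrow> \<xi> r = (\<Oplus>\<^bsub>M\<^esub>c\<in>\<Lambda>. y r c (e c))"
proof -
  let ?P = "direct_power \<Lambda> M"
  interpret P: right_module R ?P
    using right_module_direct_power right_module_axioms by blast
  interpret S: ring S
    unfolding S_def using ring_End_ring right_module_axioms by blast
  have cP: "carrier ?P = \<Lambda> \<rightarrow>\<^sub>E carrier M"
    by (rule carrier_direct_power_finite) fact
  have yh: "y r c \<in> mod_hom R M M" if "r \<in> \<Lambda>" "c \<in> \<Lambda>" for r c
    using y[OF that] by (simp add: S_def End_ring_def)
  have ycl: "y r c m \<in> carrier M" if "r \<in> \<Lambda>" "c \<in> \<Lambda>" "m \<in> carrier M" for r c m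
    using yh[OF that(1,2)] that(3) by (auto simp: mod_hom_def)
  have yz: "y r c \<zero>\<^bsub>M\<^esub> = \<zero>\<^bsub>M\<^esub>" if "r \<in> \<Lambda>" "c \<in> \<Lambda>" for r c
    using abelian_group_hom.hom_zero mod_hom_abelian_group_hom[OF _ _ yh[OF that]]
      M.abelian_group_axioms by blast
  \<comment> \<open>The action of the matrix \<open>y\<close>; the outer restriction makes it
    extensional, as elements of \<open>End_ring\<close> have to be.\<close>
  define \<Phi> where "\<Phi> = (\<lambda>f\<in>carrier ?P. \<lambda>r\<in>\<Lambda>. \<Oplus>\<^bsub>M\<^esub>c\<in>\<Lambda>. y r c (f c))"
  have "\<Phi> \<in> carrier (End_ring R ?P)"
    using mod_hom_matrix[OF yh fin] P.abelian_group_axioms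
    by (auto simp: End_ring_def \<Phi>_def mod_hom_def Pi_iff)
  then have "direct_summand (\<Phi> ` carrier ?P) R ?P"
    using rick by (auto simp: d_rickart_def)
  then obtain p where p: "p \<in> mod_hom R ?P ?P"
    and ker: "\<And>f. f \<in> carrier ?P \<Longrightarrow> p f = \<zero>\<^bsub>?P\<^esub> \<longleftrightarrow> f \<in> \<Phi> ` carrier ?P"
    by (rule P.direct_summand_kernel) (rule that)
  interpret p: abelian_group_hom ?P ?P p
    by (rule mod_hom_abelian_group_hom[OF _ _ p]) unfold_locales
  \<comment> \<open>The embedding of \<open>M\<close> as the \<open>r\<close>-th coordinate of the
    direct power.\<close>
  define \<iota> where "\<iota> r m = (\<lambda>i\<in>\<Lambda>. if i = r then m else \<zero>\<^bsub>M\<^esub>)" for r m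
  have \<iota>c: "\<iota> r m \<in> carrier ?P" if "m \<in> carrier M" for r m
    using that by (auto simp: cP \<iota>_def)
  have \<iota>_add: "\<iota> r (m \<oplus>\<^bsub>M\<^esub> m') = \<iota> r m \<oplus>\<^bsub>?P\<^esub> \<iota> r m'" for r m m'
    by (auto simp: \<iota>_def direct_power_ops fun_eq_iff)
  have \<iota>_smult: "\<iota> r (a \<odot>\<^bsub>M\<^esub> m) = a \<odot>\<^bsub>?P\<^esub> \<iota> r m" if "a \<in> carrier R" for r a m
    using that by (auto simp: \<iota>_def direct_power_ops fun_eq_iff r_null)
  have sum_\<iota>: "(\<Oplus>\<^bsub>?P\<^esub>r\<in>\<Lambda>. \<iota> r (g r)) = (\<lambda>r\<in>\<Lambda>. g r)" if g: "g \<in> \<Lambda> \<rightarrow> carrier M" for g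
  proof (rule direct_power_eqI)
    show "(\<Oplus>\<^bsub>?P\<^esub>r\<in>\<Lambda>. \<iota> r (g r)) \<in> carrier ?P" "(\<lambda>r\<in>\<Lambda>. g r) \<in> carrier ?P"
      using g by (auto simp: cP[symmetric] intro!: P.finsum_closed \<iota>c) (auto simp: cP)
    fix i assume i: "i \<in> \<Lambda>"
    interpret pr: abelian_group_hom ?P M "\<lambda>f. f i"
      by (rule abelian_group_hom_direct_power_proj[OF M.abelian_group_axioms i])
    have "(\<Oplus>\<^bsub>?P\<^esub>r\<in>\<Lambda>. \<iota> r (g r)) i = (\<Oplus>\<^bsub>M\<^esub>r\<in>\<Lambda>. \<iota> r (g r) i)"
      using g by (intro pr.hom_finsum) (auto intro!: \<iota>c)
    also have "\<dots> = (\<Oplus>\<^bsub>M\<^esub>r\<in>\<Lambda>. if i = r then g r else \<zero>\<^bsub>M\<^esub>)"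
      using i g by (intro M.finsum_cong') (auto simp: \<iota>_def)
    also have "\<dots> = g i"
      using i fin g by (rule M.finsum_singleton)
    finally show "(\<Oplus>\<^bsub>?P\<^esub>r\<in>\<Lambda>. \<iota> r (g r)) i = (\<lambda>r\<in>\<Lambda>. g r) i"
      using i by simp
  qed
  \<comment> \<open>The entry of \<open>p\<close> at row \<open>i\<close> and column
    \<open>r\<close>: embed at \<open>r\<close>, apply \<open>p\<close>, read off coordinate
    \<open>i\<close>.\<close>
  define s where "s i r = (\<lambda>m\<in>carrier M. p (\<iota> r m) i)" for i r
  have sS: "s i r \<in> carrier S" if "i \<in> \<Lambda>" for i r
  proof -
    have "p (\<iota> r m) i \<in> carrier M" if "m \<in> carrier M" for m
      using p.hom_closed[OF \<iota>c[OF that]] \<open>i \<in> \<Lambda>\<close> by (rule direct_power_mem)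
    moreover have "p (\<iota> r (a \<odot>\<^bsub>M\<^esub> m)) i = a \<odot>\<^bsub>M\<^esub> p (\<iota> r m) i" if "a \<in> carrier R" "m \<in> carrier M" for a m
    proof -
      have "p (\<iota> r (a \<odot>\<^bsub>M\<^esub> m)) = a \<odot>\<^bsub>?P\<^esub> p (\<iota> r m)"
        using p \<iota>c that unfolding mod_hom_def by (simp add: \<iota>_smult)
      then show ?thesis using \<open>i \<in> \<Lambda>\<close> by (simp add: direct_power_ops)
    qed
    moreover have "p (\<iota> r (m \<oplus>\<^bsub>M\<^esub> m')) i = p (\<iota> r m) i \<oplus>\<^bsub>M\<^esub> p (\<iota> r m') i"
      if "m \<in> carrier M" "m' \<in> carrier M" for m m'
    proof -
      have "p (\<iota> r (m \<oplus>\<^bsub>M\<^esub> m')) = p (\<iota> r m) \<oplus>\<^bsub>?P\<^esub> p (\<iota> r m')"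
        using \<iota>c that by (simp add: \<iota>_add)
      then show ?thesis using \<open>i \<in> \<Lambda>\<close> by (simp add: direct_power_ops)
    qed
    ultimately show ?thesis
      by (auto simp: s_def S_def End_ring_def mod_hom_def)
  qed
  \<comment> \<open>The matrix \<open>s\<close> acts as \<open>p\<close>: a family is the sum of its
    embedded coordinates, and both \<open>p\<close> and the coordinate projection are
    additive.\<close>
  have s_sum: "(\<Oplus>\<^bsub>M\<^esub>r\<in>\<Lambda>. s i r (g r)) = p (\<lambda>r\<in>\<Lambda>. g r) i"
    if g: "g \<in> \<Lambda> \<rightarrow> carrier M" and i: "i \<in> \<Lambda>" for g i
  proof -
    interpret pr: abelian_group_hom ?P M "\<lambda>f. f i"
      by (rule abelian_group_hom_direct_power_proj[OF M.abelian_group_axioms i])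
    have \<iota>g: "(\<lambda>r. \<iota> r (g r)) \<in> \<Lambda> \<rightarrow> carrier ?P"
      using g by (auto intro!: \<iota>c)
    have "p (\<lambda>r\<in>\<Lambda>. g r) i = (\<Oplus>\<^bsub>?P\<^esub>r\<in>\<Lambda>. p (\<iota> r (g r))) i"
      using p.hom_finsum[OF \<iota>g] sum_\<iota>[OF g] by simp
    also have "\<dots> = (\<Oplus>\<^bsub>M\<^esub>r\<in>\<Lambda>. p (\<iota> r (g r)) i)"
      using \<iota>g by (intro pr.hom_finsum) (auto simp: Pi_iff)
    also have "\<dots> = (\<Oplus>\<^bsub>M\<^esub>r\<in>\<Lambda>. s i r (g r))"
      using sS[OF i] g by (intro M.finsum_cong') (auto simp: s_def S_def End_ring_def mod_hom_def Pi_iff)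
    finally show ?thesis ..
  qed
  \<comment> \<open>This is \<open>p \<circ> \<Phi> = 0\<close> read entry by entry, so each row of
    \<open>s\<close> is a left relation between the rows of \<open>y\<close>.\<close>
  have "(\<Oplus>\<^bsub>S\<^esub>r\<in>\<Lambda>. s i r \<otimes>\<^bsub>S\<^esub> y r c) = \<zero>\<^bsub>S\<^esub>" if i: "i \<in> \<Lambda>" and c: "c \<in> \<Lambda>" for i c
  proof -
    have sy: "(\<lambda>r. s i r \<otimes>\<^bsub>S\<^esub> y r c) \<in> \<Lambda> \<rightarrow> carrier S"
      using i c y sS by auto
    have "(\<Oplus>\<^bsub>S\<^esub>r\<in>\<Lambda>. s i r \<otimes>\<^bsub>S\<^esub> y r c) m = \<zero>\<^bsub>M\<^esub>" if m: "m \<in> carrier M" for m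
    proof -
      \<comment> \<open>Evaluation at \<open>m\<close> is additive, so it turns the sum of
        endomorphisms into a sum in \<open>M\<close>.\<close>
      interpret ev: abelian_group_hom S M "\<lambda>f. f m"
        using m by (intro abelian_group_homI_add S.abelian_group_axioms M.abelian_group_axioms)
          (auto simp: S_def End_ring_def mod_hom_def)
      have "(\<Oplus>\<^bsub>S\<^esub>r\<in>\<Lambda>. s i r \<otimes>\<^bsub>S\<^esub> y r c) m = (\<Oplus>\<^bsub>M\<^esub>r\<in>\<Lambda>. (s i r \<otimes>\<^bsub>S\<^esub> y r c) m)"
        using sy by (rule ev.hom_finsum)
      also have "\<dots> = (\<Oplus>\<^bsub>M\<^esub>r\<in>\<Lambda>. s i r (y r c m))"
        using m c by (simp add: S_def End_ring_def compose_def)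
      also have "\<dots> = p (\<lambda>r\<in>\<Lambda>. y r c m) i"
        using c m i by (intro s_sum) (auto intro!: ycl)
      \<comment> \<open>Column \<open>c\<close> evaluated at \<open>m\<close> is the image under
        \<open>\<Phi>\<close> of the family with the single entry \<open>m\<close> at
        \<open>c\<close>; hence \<open>p\<close> kills it.\<close>
      also have "(\<lambda>r\<in>\<Lambda>. y r c m) = \<Phi> (\<iota> c m)"
      proof -
        have "(\<Oplus>\<^bsub>M\<^esub>c'\<in>\<Lambda>. y r c' (\<iota> c m c')) = y r c m" if "r \<in> \<Lambda>" for r
        proof -
          have "(\<Oplus>\<^bsub>M\<^esub>c'\<in>\<Lambda>. y r c' (\<iota> c m c')) = (\<Oplus>\<^bsub>M\<^esub>c'\<in>\<Lambda>. if c = c' then y r c' m else \<zero>\<^bsub>M\<^esub>)"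
            using that m by (intro M.finsum_cong') (auto simp: \<iota>_def yz ycl)
          also have "\<dots> = y r c m"
            using that m c fin by (intro M.finsum_singleton) (auto simp: ycl)
          finally show ?thesis .
        qed
        then show ?thesis
          using \<iota>c[OF m] by (auto simp: \<Phi>_def cong: restrict_cong)
      qed
      also have "p (\<Phi> (\<iota> c m)) = \<zero>\<^bsub>?P\<^esub>"
      proof -
        have "\<Phi> (\<iota> c m) \<in> carrier ?P"
          using \<iota>c[OF m] \<open>\<Phi> \<in> _\<close> by (auto simp: End_ring_def mod_hom_def)
        then show ?thesis using ker \<iota>c[OF m] by blast
      qed
      finally show ?thesis using i by (simp add: direct_power_ops)
    qed
    \<comment> \<open>Equality in \<open>S\<close> is equality of functions, so values outside the
      carrier must agree as well.\<close>
    moreover have "(\<Oplus>\<^bsub>S\<^esub>r\<in>\<Lambda>. s i r \<otimes>\<^bsub>S\<^esub> y r c) \<in> extensional (carrier M)"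
      using S.finsum_closed[OF sy] by (simp add: S_def End_ring_def)
    ultimately show ?thesis
      by (auto simp: S_def End_ring_def extensional_def fun_eq_iff)
  qed
  then have "(\<Oplus>\<^bsub>M\<^esub>r\<in>\<Lambda>. s i r (\<xi> r)) = \<zero>\<^bsub>M\<^esub>" if "i \<in> \<Lambda>" for i
    using that sS by (intro rel) auto
  then have p\<xi>: "p (\<lambda>r\<in>\<Lambda>. \<xi> r) i = \<zero>\<^bsub>M\<^esub>" if "i \<in> \<Lambda>" for i
    using s_sum[OF \<xi>] that by simp
  have \<xi>c: "(\<lambda>r\<in>\<Lambda>. \<xi> r) \<in> carrier ?P"
    using \<xi> by (auto simp: cP)
  have "p (\<lambda>r\<in>\<Lambda>. \<xi> r) = \<zero>\<^bsub>?P\<^esub>"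
    by (rule direct_power_eqI[OF p.hom_closed[OF \<xi>c] P.zero_closed]) (simp add: p\<xi> direct_power_ops)
  then have "(\<lambda>r\<in>\<Lambda>. \<xi> r) \<in> \<Phi> ` carrier ?P"
    unfolding ker[OF \<xi>c] .
  then obtain e where e: "e \<in> carrier ?P" "(\<lambda>r\<in>\<Lambda>. \<xi> r) = \<Phi> e"
    by (rule imageE)
  show thesis
  proof
    show "e \<in> \<Lambda> \<rightarrow> carrier M" using e(1) by (auto simp: cP)
    fix r assume "r \<in> \<Lambda>"
    then show "\<xi> r = (\<Oplus>\<^bsub>M\<^esub>c\<in>\<Lambda>. y r c (e c))"
      using fun_cong[OF e(2), of r] e(1) by (simp add: \<Phi>_def)
  qed
qed

end

section \<open>Equalizers and the extension of homomorphisms\<close>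

text \<open>Lets an equality of homomorphisms be checked on generators: the set where they agree is
  a submodule, so it contains the span of any of its subsets.\<close>

lemma (in submodule) submodule_equalizer:
  assumes "left_module R M" "left_module R N"
    and f: "f \<in> mod_hom R (M\<lparr>carrier := H\<rparr>) N" and g: "g \<in> mod_hom R (M\<lparr>carrier := H\<rparr>) N"
  shows "submodule {x \<in> H. f x = g x} R M"
proof -
  interpret M: left_module R M by fact
  interpret N: left_module R N by fact
  interpret H: left_module R "M\<lparr>carrier := H\<rparr>"
    by (rule left_module_submodule) fact
  interpret f: abelian_group_hom "M\<lparr>carrier := H\<rparr>" N f
    by (rule mod_hom_abelian_group_hom[OF _ _ f]) unfold_locales
  interpret g: abelian_group_hom "M\<lparr>carrier := H\<rparr>" N g
    by (rule mod_hom_abelian_group_hom[OF _ _ g]) unfold_locales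
  \<comment> \<open>Negation depends on the carrier of the structure; the homomorphism laws for
    \<open>f\<close> and \<open>g\<close> speak of negation inside \<open>H\<close>.\<close>
  have inv: "\<ominus>\<^bsub>M\<^esub> x = \<ominus>\<^bsub>M\<lparr>carrier := H\<rparr>\<^esub> x" if "x \<in> H" for x
    using M.add.m_inv_consistent[OF subgroup_axioms that] by (simp add: a_inv_def)
  show ?thesis
  proof (intro submodule.intro subgroup.intro submodule_axioms.intro)
    show "{x \<in> H. f x = g x} \<subseteq> carrier (add_monoid M)"
      using subset by auto
    show "\<one>\<^bsub>add_monoid M\<^esub> \<in> {x \<in> H. f x = g x}"
      using one_closed f.hom_zero g.hom_zero by simp
  next
    fix x y assume "x \<in> {x \<in> H. f x = g x}" "y \<in> {x \<in> H. f x = g x}"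
    then show "x \<otimes>\<^bsub>add_monoid M\<^esub> y \<in> {x \<in> H. f x = g x}"
      using m_closed f.hom_add[of x y] g.hom_add[of x y] by auto
  next
    fix x assume "x \<in> {x \<in> H. f x = g x}"
    then have x: "x \<in> H" "f x = g x"
      by auto
    then have "f (\<ominus>\<^bsub>M\<^esub> x) = g (\<ominus>\<^bsub>M\<^esub> x)"
      using f.hom_a_inv[of x] g.hom_a_inv[of x] by (simp add: inv)
    moreover have "\<ominus>\<^bsub>M\<^esub> x \<in> H"
      using m_inv_closed[OF x(1)] by (simp add: a_inv_def)
    ultimately show "inv\<^bsub>add_monoid M\<^esub> x \<in> {x \<in> H. f x = g x}"
      by (simp add: a_inv_def)
  next
    fix a x assume "a \<in> carrier R" "x \<in> {x \<in> H. f x = g x}"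
    then show "a \<odot>\<^bsub>M\<^esub> x \<in> {x \<in> H. f x = g x}"
      using f g by (auto simp: mod_hom_def)
  qed
qed

theorem proposition5p2:
  fixes A :: "('r, 'p) ring_scheme" and X :: "('r, 'x, 'q) module_scheme"
  assumes "ring A" and "right_module A X"
    and "sigma_d_rickart TYPE('i::infinite) A X"
  shows "fp_injective (End_ring A X) (End_module X)"
proof -
  define S where "S = End_ring A X"
  define N where "N = End_module X"
  define F where "F = free_left_module S"
  interpret X: right_module A X by fact
  interpret S: ring S unfolding S_def by (rule ring_End_ring) fact
  interpret N: left_module S N unfolding S_def N_def by (rule left_module_End_module) fact
  interpret F: left_module S F unfolding F_def by (rule left_module_free) unfold_locales
  have N_simps: "carrier N = carrier X" "zero N = zero X" "add N = add X" "smult N = (\<lambda>f x. f x)"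
    by (simp_all add: N_def End_module_def)
  \<comment> \<open>With index set \<open>UNIV\<close> all restrictions disappear: elements of
    \<open>F\<close> are rows over \<open>S\<close> with finitely many non-zero entries.\<close>
  have F_simps: "carrier F = {f. (\<forall>n. f n \<in> carrier S) \<and> finite {n. f n \<noteq> \<zero>\<^bsub>S\<^esub>}}"
    "\<zero>\<^bsub>F\<^esub> = (\<lambda>n. \<zero>\<^bsub>S\<^esub>)" "f \<oplus>\<^bsub>F\<^esub> g = (\<lambda>n. f n \<oplus>\<^bsub>S\<^esub> g n)" "a \<odot>\<^bsub>F\<^esub> f = (\<lambda>n. a \<otimes>\<^bsub>S\<^esub> f n)" for f g a
    by (auto simp: F_def free_left_module_def direct_power_def regular_left_module_def PiE_def)
  \<comment> \<open>\<open>N\<close> and \<open>X\<close> are different records with the same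
    additive structure; sums are transferred along the identity map.\<close>
  have N_finsum: "(\<Oplus>\<^bsub>N\<^esub>i\<in>I. f i) = (\<Oplus>\<^bsub>X\<^esub>i\<in>I. f i)" if "f \<in> I \<rightarrow> carrier X" for f and I :: "'i set"
  proof -
    interpret abelian_group_hom N X "\<lambda>x. x"
      by (intro abelian_group_homI_add N.abelian_group_axioms X.abelian_group_axioms) (auto simp: N_simps)
    show ?thesis using hom_finsum[of f I] that by (simp add: N_simps)
  qed
  have S_hom: "a \<in> mod_hom A X X" if "a \<in> carrier S" for a
    using that by (simp add: S_def End_ring_def)
  have S_closed: "a x \<in> carrier X" if "a \<in> carrier S" "x \<in> carrier X" for a x
    using S_hom[OF that(1)] that(2) by (auto simp: mod_hom_def)
  have "\<exists>\<eta> \<in> mod_hom S F N. \<forall>x\<in>L. \<psi> x = \<eta> (\<phi> x)"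
    if fg: "fg_submodule L S F" and \<phi>: "\<phi> \<in> mod_hom S (F\<lparr>carrier := L\<rparr>) F" and inj: "inj_on \<phi> L"
      and \<psi>: "\<psi> \<in> mod_hom S (F\<lparr>carrier := L\<rparr>) N" for L \<phi> \<psi>
  proof -
    obtain G where L: "submodule L S F" and G: "finite G" "L = mod_span S F G"
      using fg unfolding fg_submodule_def by blast
    have GL: "G \<subseteq> L"
      unfolding G(2) mod_span_def by auto
    interpret L: submodule L S F by fact
    let ?L = "F\<lparr>carrier := L\<rparr>"
    interpret Lm: left_module S ?L
      by (rule L.left_module_submodule) unfold_locales
    interpret \<phi>: abelian_group_hom ?L F \<phi>
      by (rule mod_hom_abelian_group_hom[OF _ _ \<phi>]) unfold_locales
    interpret \<psi>: abelian_group_hom ?L N \<psi>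
      by (rule mod_hom_abelian_group_hom[OF _ _ \<psi>]) unfold_locales
    have \<phi>F: "\<phi> l \<in> carrier F" if "l \<in> L" for l
      using \<phi>.hom_closed that by simp
    have \<psi>X: "\<psi> l \<in> carrier X" if "l \<in> L" for l
      using \<psi>.hom_closed[of l] that by (simp add: N_simps)

    obtain xs where xs: "set xs = G"
      using finite_list[OF G(1)] by auto
    \<comment> \<open>Padding the generators by zeros allows as many rows as columns, so that the
      matrix is square.\<close>
    define g where "g i = (if i < length xs then xs ! i else \<zero>\<^bsub>F\<^esub>)" for i
    have gL: "g i \<in> L" for i
      using GL xs L.one_closed by (auto simp: g_def)
    have "finite (\<Union>l\<in>G. {n. \<phi> l n \<noteq> \<zero>\<^bsub>S\<^esub>})"
      using \<phi>F GL G(1) by (auto simp: F_simps)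
    then obtain b where b: "(\<Union>l\<in>G. {n. \<phi> l n \<noteq> \<zero>\<^bsub>S\<^esub>}) \<subseteq> {..<b}"
      unfolding finite_nat_set_iff_bounded by blast
    \<comment> \<open>Large enough for all generators and for the supports of their images;
      \<open>Suc\<close> keeps the index set \<open>\<Lambda>\<close> non-empty even if there are no
      generators.\<close>
    define k where "k = Suc (b + length xs)"
    have \<phi>g_zero: "\<phi> (g i) n = \<zero>\<^bsub>S\<^esub>" if "n \<ge> k" for i n
    proof (cases "i < length xs")
      case True
      then have "g i \<in> G" using xs by (auto simp: g_def)
      then show ?thesis using b that by (force simp: k_def)
    next
      case False
      then show ?thesis using \<phi>.hom_zero by (simp add: g_def F_simps)
    qed
    \<comment> \<open>The hypothesis on \<open>X\<close> concerns index sets in \<open>'i\<close>,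
      so the indices below \<open>k\<close> are moved there by an injection \<open>h\<close> with
      left inverse \<open>\<beta>\<close>.\<close>
    obtain h :: "nat \<Rightarrow> 'i" where h: "inj h"
      using infinite_countable_subset[OF infinite_UNIV] by blast
    define \<beta> where "\<beta> = inv_into UNIV h"
    have \<beta>: "\<beta> (h n) = n" for n
      using h by (simp add: \<beta>_def)
    define \<Lambda> where "\<Lambda> = h ` {..<k}"
    have "\<Lambda> \<noteq> {}" by (auto simp: \<Lambda>_def k_def)
    then have rick: "d_rickart A (direct_power \<Lambda> X)"
      using assms(3) by (auto simp: sigma_d_rickart_def)
    \<comment> \<open>Row \<open>r\<close> of the system holds the first \<open>k\<close>
      coordinates of the image of a generator under \<open>\<phi>\<close>; the right-hand side is
      its image under \<open>\<psi>\<close>.\<close>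
    obtain e where e: "e \<in> \<Lambda> \<rightarrow> carrier X"
      and eq: "\<And>r. r \<in> \<Lambda> \<Longrightarrow> \<psi> (g (\<beta> r)) = (\<Oplus>\<^bsub>X\<^esub>c\<in>\<Lambda>. \<phi> (g (\<beta> r)) (\<beta> c) (e c))"
    proof (rule X.matrix_equation_solvable[of \<Lambda> "\<lambda>r c. \<phi> (g (\<beta> r)) (\<beta> c)" "\<lambda>r. \<psi> (g (\<beta> r))"])
      show "finite \<Lambda>" by (simp add: \<Lambda>_def)
      show "d_rickart A (direct_power \<Lambda> X)" by (rule rick)
      show "\<phi> (g (\<beta> r)) (\<beta> c) \<in> carrier (End_ring A X)" for r c
        using \<phi>F[OF gL] by (simp add: F_simps S_def)
      show "(\<lambda>r. \<psi> (g (\<beta> r))) \<in> \<Lambda> \<rightarrow> carrier X"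
        using \<psi>X[OF gL] by simp
      fix s assume "s \<in> \<Lambda> \<rightarrow> carrier (End_ring A X)"
        and "\<And>c. c \<in> \<Lambda> \<Longrightarrow> (\<Oplus>\<^bsub>End_ring A X\<^esub>r\<in>\<Lambda>. s r \<otimes>\<^bsub>End_ring A X\<^esub> \<phi> (g (\<beta> r)) (\<beta> c)) = \<zero>\<^bsub>End_ring A X\<^esub>"
      then have s: "s \<in> \<Lambda> \<rightarrow> carrier S"
        and s0: "\<And>c. c \<in> \<Lambda> \<Longrightarrow> (\<Oplus>\<^bsub>S\<^esub>r\<in>\<Lambda>. s r \<otimes>\<^bsub>S\<^esub> \<phi> (g (\<beta> r)) (\<beta> c)) = \<zero>\<^bsub>S\<^esub>"
        by (simp_all add: S_def)
      \<comment> \<open>The combination of generators with coefficients \<open>s\<close>. The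
        relation says that \<open>\<phi> z = 0\<close>, injectivity then gives \<open>z = 0\<close>,
        and applying \<open>\<psi>\<close> yields the relation required.\<close>
      define z where "z = (\<Oplus>\<^bsub>?L\<^esub>r\<in>\<Lambda>. s r \<odot>\<^bsub>F\<^esub> g (\<beta> r))"
      have sg: "(\<lambda>r. s r \<odot>\<^bsub>F\<^esub> g (\<beta> r)) \<in> \<Lambda> \<rightarrow> carrier ?L"
        using s gL by auto
      then have z: "z \<in> L"
        using Lm.finsum_closed[OF sg] by (simp add: z_def)
      have \<phi>sg: "\<phi> (s r \<odot>\<^bsub>F\<^esub> g (\<beta> r)) = s r \<odot>\<^bsub>F\<^esub> \<phi> (g (\<beta> r))"
        and \<psi>sg: "\<psi> (s r \<odot>\<^bsub>F\<^esub> g (\<beta> r)) = s r (\<psi> (g (\<beta> r)))" if "r \<in> \<Lambda>" for r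
        using \<phi> \<psi> s gL that by (auto simp: mod_hom_def N_simps Pi_iff)
      have s\<psi>: "s r (\<psi> (g (\<beta> r))) \<in> carrier X" if "r \<in> \<Lambda>" for r
        by (rule S_closed[OF funcset_mem[OF s that] \<psi>X[OF gL]])
      have "\<phi> z n = \<zero>\<^bsub>S\<^esub>" for n
      proof -
        interpret pr: abelian_group_hom F S "\<lambda>f. f n"
          by (intro abelian_group_homI_add F.abelian_group_axioms S.abelian_group_axioms) (auto simp: F_simps)
        have "\<phi> z n = (\<Oplus>\<^bsub>F\<^esub>r\<in>\<Lambda>. \<phi> (s r \<odot>\<^bsub>F\<^esub> g (\<beta> r))) n"
          unfolding z_def using sg by (subst \<phi>.hom_finsum) auto
        also have "\<dots> = (\<Oplus>\<^bsub>S\<^esub>r\<in>\<Lambda>. \<phi> (s r \<odot>\<^bsub>F\<^esub> g (\<beta> r)) n)"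
          using sg \<phi>F by (intro pr.hom_finsum) (auto simp: Pi_iff)
        also have "\<dots> = (\<Oplus>\<^bsub>S\<^esub>r\<in>\<Lambda>. s r \<otimes>\<^bsub>S\<^esub> \<phi> (g (\<beta> r)) n)"
          using s \<phi>F[OF gL] by (intro S.finsum_cong') (simp_all add: \<phi>sg, auto simp: F_simps Pi_iff)
        \<comment> \<open>The assumed relation covers the coordinates below \<open>k\<close>; all
          later coordinates vanish by the choice of \<open>k\<close>.\<close>
        also have "\<dots> = \<zero>\<^bsub>S\<^esub>"
        proof (cases "n < k")
          case True
          then show ?thesis using s0[of "h n"] by (simp add: \<beta> \<Lambda>_def)
        next
          case False
          then have "(\<Oplus>\<^bsub>S\<^esub>r\<in>\<Lambda>. s r \<otimes>\<^bsub>S\<^esub> \<phi> (g (\<beta> r)) n) = (\<Oplus>\<^bsub>S\<^esub>r\<in>\<Lambda>. \<zero>\<^bsub>S\<^esub>)"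
            using s by (intro S.finsum_cong') (auto simp: \<phi>g_zero Pi_iff)
          then show ?thesis by simp
        qed
        finally show ?thesis .
      qed
      then have "\<phi> z = \<phi> \<zero>\<^bsub>F\<^esub>"
        using \<phi>.hom_zero by (auto simp: F_simps)
      then have "z = \<zero>\<^bsub>F\<^esub>"
        using inj z L.one_closed by (auto dest: inj_onD)
      then have "\<psi> z = \<zero>\<^bsub>X\<^esub>"
        using \<psi>.hom_zero by (simp add: N_simps)
      moreover have "\<psi> z = (\<Oplus>\<^bsub>X\<^esub>r\<in>\<Lambda>. \<psi> (s r \<odot>\<^bsub>F\<^esub> g (\<beta> r)))"
        unfolding z_def using sg \<psi>X by (subst \<psi>.hom_finsum, simp, intro N_finsum) (auto simp: Pi_iff)
      moreover have "\<dots> = (\<Oplus>\<^bsub>X\<^esub>r\<in>\<Lambda>. s r (\<psi> (g (\<beta> r))))"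
        using s\<psi> by (intro X.finsum_cong') (simp_all add: \<psi>sg)
      ultimately show "(\<Oplus>\<^bsub>X\<^esub>r\<in>\<Lambda>. s r (\<psi> (g (\<beta> r)))) = \<zero>\<^bsub>X\<^esub>"
        by simp
    qed (rule that)
    \<comment> \<open>The homomorphism sending the \<open>n\<close>-th basis vector of
      \<open>F\<close> to \<open>e (h n)\<close> for \<open>n < k\<close> and the remaining basis
      vectors to zero.\<close>
    define \<eta> where "\<eta> f = (\<Oplus>\<^bsub>X\<^esub>c\<in>\<Lambda>. f (\<beta> c) (e c))" for f :: "nat \<Rightarrow> 'x \<Rightarrow> 'x"
    have fe: "(\<lambda>c. f (\<beta> c) (e c)) \<in> \<Lambda> \<rightarrow> carrier X" if "f \<in> carrier F" for f
    proof
      fix c assume "c \<in> \<Lambda>"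
      moreover have "f (\<beta> c) \<in> carrier S" using that by (simp add: F_simps)
      ultimately show "f (\<beta> c) (e c) \<in> carrier X" using e by (blast intro: S_closed[of "f (\<beta> c)" "e c"])
    qed
    have \<eta>: "\<eta> \<in> mod_hom S F N"
      unfolding mod_hom_def
    proof (intro CollectI conjI ballI Pi_I)
      fix f assume "f \<in> carrier F"
      then show "\<eta> f \<in> carrier N"
        unfolding \<eta>_def N_simps by (intro X.finsum_closed fe)
    next
      fix f f' assume f: "f \<in> carrier F" "f' \<in> carrier F"
      have "\<eta> (f \<oplus>\<^bsub>F\<^esub> f') = (\<Oplus>\<^bsub>X\<^esub>c\<in>\<Lambda>. f (\<beta> c) (e c) \<oplus>\<^bsub>X\<^esub> f' (\<beta> c) (e c))"
        unfolding \<eta>_def using fe[OF f(1)] fe[OF f(2)] e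
        by (intro X.finsum_cong') (auto simp: F_simps S_def End_ring_def Pi_iff)
      then show "\<eta> (f \<oplus>\<^bsub>F\<^esub> f') = \<eta> f \<oplus>\<^bsub>N\<^esub> \<eta> f'"
        using fe[OF f(1)] fe[OF f(2)] by (simp add: \<eta>_def N_simps X.finsum_addf)
    next
      fix a f assume a: "a \<in> carrier S" and f: "f \<in> carrier F"
      interpret a: abelian_group_hom X X a
        by (rule mod_hom_abelian_group_hom[OF _ _ S_hom[OF a]]) unfold_locales
      have "\<eta> (a \<odot>\<^bsub>F\<^esub> f) = (\<Oplus>\<^bsub>X\<^esub>c\<in>\<Lambda>. a (f (\<beta> c) (e c)))"
        unfolding \<eta>_def using fe[OF f] e
        by (intro X.finsum_cong') (auto simp: F_simps S_def End_ring_def Pi_iff compose_def)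
      then show "\<eta> (a \<odot>\<^bsub>F\<^esub> f) = a \<odot>\<^bsub>N\<^esub> \<eta> f"
        using a.hom_finsum[OF fe[OF f]] by (simp add: \<eta>_def N_simps)
    qed
    have "submodule {l \<in> L. \<psi> l = (\<eta> \<circ> \<phi>) l} S F"
    proof (rule L.submodule_equalizer)
      show "\<eta> \<circ> \<phi> \<in> mod_hom S ?L N"
        using \<phi> \<eta> by (auto simp: mod_hom_def)
    qed (unfold_locales, rule \<psi>)
    then interpret E: submodule "{l \<in> L. \<psi> l = (\<eta> \<circ> \<phi>) l}" S F .
    \<comment> \<open>For the generator \<open>g i\<close>, the claim is row \<open>h i\<close> of
      the solved system, since \<open>\<beta> (h i) = i\<close>.\<close>
    have "G \<subseteq> {l \<in> L. \<psi> l = (\<eta> \<circ> \<phi>) l}"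
    proof
      fix l assume "l \<in> G"
      then obtain i where i: "i < length xs" "l = g i"
        using xs by (auto simp: g_def in_set_conv_nth)
      then have "h i \<in> \<Lambda>" by (simp add: \<Lambda>_def k_def)
      then show "l \<in> {l \<in> L. \<psi> l = (\<eta> \<circ> \<phi>) l}"
        using eq[of "h i"] gL i by (simp add: \<beta> \<eta>_def)
    qed
    then have "L \<subseteq> {l \<in> L. \<psi> l = (\<eta> \<circ> \<phi>) l}"
      unfolding G(2) using E.mod_span_subset by (simp add: G(2))
    with \<eta> show ?thesis by auto
  qed
  then show ?thesis
    unfolding fp_injective_def S_def N_def F_def by blast
qed

end
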